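(* Let $D_1, D_2, D_3 \subset \mathbb{CP}(1)$ be pairwise disjoint open discs, let $\mathfrak D = (D_1,D_2,D_3)$, and let $p_1,p_2,p_3 \in \mathfrak P_2$ be non-zero polynomials such that both roots of $p_j$ are contained in $D_j$ for $j=1,2,3$. Then $\Delta(p_1,p_2,p_3) \neq 0$ and the polynomial $[p_2,p_3]\,[p_3,p_1]\,[p_1,p_2]$ is subordinate to $\mathfrak D$.
   Context: $\mathfrak P_k$ is the space of complex polynomials (in $x$) of degree $\le k$; for a polynomial $f$, $f_j$ is the coefficient of $x^j$. Roots are counted with multiplicity in $\mathbb{CP}(1)=\mathbb C\cup\{\infty\}$: a non-zero $p\in\mathfrak P_2$ has $\infty$ as a root of multiplicity $2-\deg p$, and a non-zero $f\in\mathfrak P_6$ has $\infty$ as a root of multiplicity $6-\deg f$. An open disc in $\mathbb{CP}(1)$ is the image of the open unit disc of $\mathbb C$ under a Möbius transformation. A non-zero $f\in\mathfrak P_6$ is subordinate to a triple $\mathfrak D=(D_1,D_2,D_3)$ of pairwise disjoint open discs if each $D_j$ contains exactly two roots of $f$, counted with multiplicity. For $p,q,r\in\mathfrak P_2$: $[p,q]=p'q-pq'$ (again an element of $\mathfrak P_2$), and $$\Delta(p,q,r)=\det\begin{pmatrix} p_0 & q_0 & r_0 \\ p_1 & q_1 & r_1 \\ p_2 & q_2 & r_2 \end{pmatrix}.$$ *)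

theory Defs
  imports "HOL-Analysis.Analysis" "HOL-Computational_Algebra.Polynomial"
begin

text \<open>The complex projective line is the one-point compactification of the complex plane:
  \<^term>\<open>Some z\<close> is the finite point \<^term>\<open>z\<close>, and \<^term>\<open>None\<close> is the point at infinity.\<close>

type_synonym cp1 = "complex option"

definition polys_upto :: "nat \<Rightarrow> complex poly set" where
  "polys_upto k = {f. degree f \<le> k}"

text \<open>The multiplicity of a point as a root of a non-zero \<^term>\<open>f \<in> polys_upto k\<close>. It depends on
  \<^term>\<open>k\<close>, not only on \<^term>\<open>f\<close>. It has no meaning for \<^term>\<open>f = 0\<close>, and the
  subtraction does not truncate as long as \<^term>\<open>f \<in> polys_upto k\<close>.\<close>

definition root_mult :: "nat \<Rightarrow> complex poly \<Rightarrow> cp1 \<Rightarrow> nat" where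
  "root_mult k f z = (case z of Some w \<Rightarrow> order w f | None \<Rightarrow> k - degree f)"

definition roots_cp1 :: "nat \<Rightarrow> complex poly \<Rightarrow> cp1 set" where
  "roots_cp1 k f = {z. root_mult k f z > 0}"

text \<open>The sum ranges over the roots in \<^term>\<open>D\<close> only, because a sum over the infinite set
  \<^term>\<open>D\<close> itself would be 0 by convention.\<close>

definition num_roots_in :: "nat \<Rightarrow> complex poly \<Rightarrow> cp1 set \<Rightarrow> nat" where
  "num_roots_in k f D = (\<Sum>z \<in> roots_cp1 k f \<inter> D. root_mult k f z)"

definition moebius :: "complex \<Rightarrow> complex \<Rightarrow> complex \<Rightarrow> complex \<Rightarrow> cp1 \<Rightarrow> cp1" where
  "moebius a b c d z =
     (case z of
        Some w \<Rightarrow> if c * w + d = 0 then None else Some ((a * w + b) / (c * w + d))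
      | None \<Rightarrow> if c = 0 then None else Some (a / c))"

definition open_disc :: "cp1 set \<Rightarrow> bool" where
  "open_disc D \<longleftrightarrow>
     (\<exists>a b c d. a * d - b * c \<noteq> 0 \<and> D = moebius a b c d ` Some ` ball 0 1)"

definition disjoint_discs :: "cp1 set \<times> cp1 set \<times> cp1 set \<Rightarrow> bool" where
  "disjoint_discs = (\<lambda>(D1, D2, D3).
     open_disc D1 \<and> open_disc D2 \<and> open_disc D3 \<and>
     D1 \<inter> D2 = {} \<and> D1 \<inter> D3 = {} \<and> D2 \<inter> D3 = {})"

definition subordinate :: "complex poly \<Rightarrow> cp1 set \<times> cp1 set \<times> cp1 set \<Rightarrow> bool" where
  "subordinate f = (\<lambda>(D1, D2, D3).
     f \<in> polys_upto 6 \<and> f \<noteq> 0 \<and> disjoint_discs (D1, D2, D3) \<and>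
     num_roots_in 6 f D1 = 2 \<and> num_roots_in 6 f D2 = 2 \<and> num_roots_in 6 f D3 = 2)"

definition bracket :: "complex poly \<Rightarrow> complex poly \<Rightarrow> complex poly" where
  "bracket p q = pderiv p * q - p * pderiv q"

definition Delta :: "complex poly \<Rightarrow> complex poly \<Rightarrow> complex poly \<Rightarrow> complex" where
  "Delta p q r = det (vector
     [vector [coeff p 0, coeff q 0, coeff r 0],
      vector [coeff p 1, coeff q 1, coeff r 1],
      vector [coeff p 2, coeff q 2, coeff r 2]] :: complex ^ 3 ^ 3)"

end

theory Submission
  imports Defs "HOL-Computational_Algebra.Fundamental_Theorem_Algebra"
begin

text \<open>The bracket is, up to normalisation, the cross product of the coefficient vectors, so that
  \<open>[q, r]\<close> is apolar to \<open>q\<close> and to \<open>r\<close>, and the apolar pairing of \<open>p\<close> with \<open>[q, r]\<close> is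
  \<open>-2 \<Delta>(p, q, r)\<close>. By Grace's theorem for quadratics, if both roots of \<open>p\<close> lie in an open disc and
  \<open>j\<close> is apolar to \<open>p\<close>, then \<open>j\<close> has a root in that disc. Hence \<open>[p\<^sub>2, p\<^sub>3]\<close> has a root in \<open>D\<^sub>2\<close> and
  one in \<open>D\<^sub>3\<close>, which exhausts its two roots. None is left for \<open>D\<^sub>1\<close>, so it cannot be apolar
  to \<open>p\<^sub>1\<close>, that is \<open>\<Delta> \<noteq> 0\<close>; and multiplying the three brackets gives two roots in each disc.\<close>

section \<open>Grace's theorem for quadratics\<close>

text \<open>By Vieta, \<open>u\<close> and \<open>v\<close> are the roots of t^2 - s t + m. This
  gives a quadratic's roots with multiplicity.\<close>

lemma complex_sum_prod_exists:
  fixes s m :: complex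
  obtains u v where "u + v = s" "u * v = m"
proof
  show "(s + csqrt (s\<^sup>2 - 4 * m)) / 2 + (s - csqrt (s\<^sup>2 - 4 * m)) / 2 = s"
    by (simp add: field_simps)
  have "(s + csqrt (s\<^sup>2 - 4 * m)) * (s - csqrt (s\<^sup>2 - 4 * m)) = s\<^sup>2 - (csqrt (s\<^sup>2 - 4 * m))\<^sup>2"
    by (simp add: power2_eq_square algebra_simps)
  then show "(s + csqrt (s\<^sup>2 - 4 * m)) / 2 * ((s - csqrt (s\<^sup>2 - 4 * m)) / 2) = m"
    by simp
qed

lemma polar_bound:
  fixes a b u :: complex
  assumes a: "norm a < 1" and b: "norm b < 1" and u: "norm u \<le> 1"
  shows "norm (a + b - 2 * u * a * b) < norm (2 - u * (a + b))"
proof -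
  \<comment> \<open>With \<open>x = a / (1 - u a)\<close>, \<open>norm a < 1\<close> becomes \<open>norm x < norm (1 + u x)\<close>, a convex condition on \<open>x\<close>
    because \<open>norm u \<le> 1\<close>; the claim is this condition at a midpoint.\<close>
  define x y where "x = a / (1 - u * a)" and "y = b / (1 - u * b)"
  have nz: "1 - u * a \<noteq> 0 \<and> norm a / norm (1 - u * a) < 1 / norm (1 - u * a)"
    if "norm a < 1" for a
  proof -
    have "norm (u * a) \<le> 1 * norm a"
      unfolding norm_mult using u by (intro mult_right_mono) auto
    with that have "norm (u * a) < 1" by simp
    then have "1 - u * a \<noteq> 0" by auto
    with that show ?thesis by (simp add: divide_strict_right_mono)
  qed
  \<comment> \<open>In this expanded form the quadratic part has the non-negative coefficient
    \<open>1 - (norm u)\<^sup>2\<close>, which makes the convexity visible.\<close>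
  define f where "f z = (1 - (norm u)\<^sup>2) * (norm z)\<^sup>2 - 2 * Re (u * z) - 1" for z
  have f_eq: "f z = (norm z)\<^sup>2 - (norm (1 + u * z))\<^sup>2" for z
    unfolding f_def cmod_power2 by (simp add: power2_eq_square algebra_simps)
  have neg: "f (a / (1 - u * a)) < 0" if "norm a < 1" for a
  proof -
    have "1 + u * (a / (1 - u * a)) = 1 / (1 - u * a)"
      using nz[OF that] by (simp add: field_simps)
    with nz[OF that] have "norm (a / (1 - u * a)) < norm (1 + u * (a / (1 - u * a)))"
      by (simp add: norm_divide)
    then show ?thesis
      unfolding f_eq by (simp add: power_strict_mono)
  qed
  have "f x < 0" "f y < 0"
    unfolding x_def y_def by (intro neg a b)+
  moreover define z R where "z = (x + y) / 2" and "R = (1 - (norm u)\<^sup>2) * (norm (x - y))\<^sup>2"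
  \<comment> \<open>Parallelogram law for the quadratic part; the remaining terms are affine and
    average exactly.\<close>
  have "f z = (f x + f y) / 2 - R / 4"
    unfolding f_def z_def R_def cmod_power2 by (simp add: power2_eq_square field_simps)
  moreover have "0 \<le> R"
    using u by (simp add: R_def power_le_one)
  ultimately have "f z < 0"
    by (simp add: field_simps)
  then have "(norm z)\<^sup>2 < (norm (1 + u * z))\<^sup>2"
    unfolding f_eq by simp
  then have "norm z < norm (1 + u * z)"
    by (rule power_less_imp_less_base) simp
  moreover define d where "d = 2 * (1 - u * a) * (1 - u * b)"
  moreover have "d \<noteq> 0"
    using nz[OF a] nz[OF b] by (simp add: d_def)
  moreover have z: "z = (a + b - 2 * u * a * b) / d"
    using nz[OF a] nz[OF b] unfolding x_def y_def z_def d_def by (simp add: field_simps)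
  moreover have "1 + u * z = (d + u * (a + b - 2 * u * a * b)) / d"
    unfolding z using \<open>d \<noteq> 0\<close> by (simp add: add_divide_distrib)
  moreover have "d + u * (a + b - 2 * u * a * b) = 2 - u * (a + b)"
    by (simp add: d_def algebra_simps)
  ultimately show ?thesis
    by (simp add: norm_divide divide_less_cancel)
qed

text \<open>If the second quadratic had no root in the disc, the reciprocals \<open>u\<close>,
  \<open>v\<close> of its roots would lie in the closed disc. Solving apolarity for \<open>v\<close>
  then contradicts \<open>polar_bound\<close>. The condition on \<open>C\<close> keeps both roots of
  the first quadratic finite.\<close>

lemma grace_unit_disc:
  fixes A B C X Y Z :: complex
  assumes C: "C \<noteq> 0"
    and inside: "\<And>w. A + B * w + C * w\<^sup>2 = 0 \<Longrightarrow> norm w < 1"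
    and apolar: "2 * A * Z - B * Y + 2 * C * X = 0"
  obtains w where "norm w < 1" "X + Y * w + Z * w\<^sup>2 = 0"
proof (rule ccontr)
  assume "\<not> thesis"
  with that have out: "X + Y * w + Z * w\<^sup>2 \<noteq> 0" if "norm w < 1" for w
    using that by blast
  obtain a b where ab: "a + b = - B / C" "a * b = A / C"
    by (rule complex_sum_prod_exists)
  have A: "A = C * (a * b)" and B: "B = - C * (a + b)"
    using C by (simp_all add: ab)
  have "norm a < 1" "norm b < 1"
    by (rule inside; simp add: A B power2_eq_square algebra_simps)+
  have X: "X \<noteq> 0"
    using out[of 0] by simp
  obtain u v where uv: "u + v = - Y / X" "u * v = Z / X"
    by (rule complex_sum_prod_exists)
  have Y: "Y = - X * (u + v)" and Z: "Z = X * (u * v)"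
    using X by (simp_all add: uv)
  \<comment> \<open>\<open>u\<close> and \<open>v\<close> are the reciprocals of the roots, so that a root at infinity needs no separate case.\<close>
  have recip: "norm t \<le> 1" if t: "t = u \<or> t = v" for t
  proof (rule ccontr)
    assume "\<not> norm t \<le> 1"
    then have "norm (1 / t) < 1" "t \<noteq> 0"
      by (auto simp: norm_divide divide_less_eq)
    moreover have "X + Y * (1 / t) + Z * (1 / t)\<^sup>2 = 0"
      using t \<open>t \<noteq> 0\<close> by (auto simp: Y Z power2_eq_square field_simps)
    ultimately show False
      using out by blast
  qed
  \<comment> \<open>Written in the roots, apolarity is affine in \<open>v\<close>; it is grouped
    here to isolate \<open>v\<close>.\<close>
  have "2 * C * X * ((2 - u * (a + b)) - v * (a + b - 2 * u * a * b)) =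
      2 * (2 * A * Z - B * Y + 2 * C * X)"
    by (simp add: A B Y Z algebra_simps)
  with apolar C X have "2 - u * (a + b) = v * (a + b - 2 * u * a * b)"
    by simp
  then have "norm (2 - u * (a + b)) = norm v * norm (a + b - 2 * u * a * b)"
    by (metis norm_mult)
  also have "\<dots> \<le> norm (a + b - 2 * u * a * b)"
    using recip[of v] by (simp add: mult_left_le_one_le)
  also have "\<dots> < norm (2 - u * (a + b))"
    using \<open>norm a < 1\<close> \<open>norm b < 1\<close> recip[of u] by (intro polar_bound) auto
  finally show False by simp
qed

section \<open>Homogeneous quadratic forms and Moebius changes of coordinate\<close>

definition quad_form :: "complex poly \<Rightarrow> complex \<Rightarrow> complex \<Rightarrow> complex" where
  "quad_form f x y = coeff f 0 * y\<^sup>2 + coeff f 1 * x * y + coeff f 2 * x\<^sup>2"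

text \<open>The symmetric bilinear form whose value at \<open>(p, p)\<close> is minus the
  discriminant of \<open>p\<close>.\<close>

definition apolar :: "complex poly \<Rightarrow> complex poly \<Rightarrow> complex" where
  "apolar p q = 2 * coeff p 0 * coeff q 2 - coeff p 1 * coeff q 1 + 2 * coeff p 2 * coeff q 0"

lemma poly_eq_quad_form:
  assumes "f \<in> polys_upto 2"
  shows "poly f x = quad_form f x 1"
proof -
  have "poly f x = (\<Sum>i\<le>2. coeff f i * x ^ i)"
    unfolding poly_altdef using assms
    by (intro sum.mono_neutral_left) (auto simp: polys_upto_def coeff_eq_0)
  then show ?thesis
    by (simp add: quad_form_def numeral_2_eq_2)
qed

lemma quad_form_scale: "quad_form f (k * x) (k * y) = k\<^sup>2 * quad_form f x y"
  by (simp add: quad_form_def power2_eq_square algebra_simps)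

lemma roots_cp1_Some:
  assumes "f \<in> polys_upto 2" "f \<noteq> 0"
  shows "Some x \<in> roots_cp1 2 f \<longleftrightarrow> quad_form f x 1 = 0"
  using assms by (simp add: roots_cp1_def root_mult_def order_gt_0_iff poly_eq_quad_form)

lemma roots_cp1_None:
  assumes "f \<in> polys_upto 2" "f \<noteq> 0"
  shows "None \<in> roots_cp1 2 f \<longleftrightarrow> quad_form f 1 0 = 0"
proof -
  have "degree f < 2 \<longleftrightarrow> coeff f 2 = 0"
    using assms by (metis coeff_eq_0 leading_coeff_0_iff linorder_neqE_nat mem_Collect_eq
        not_le polys_upto_def)
  then show ?thesis
    by (simp add: roots_cp1_def root_mult_def quad_form_def)
qed

text \<open>The image points have homogeneous coordinates (a w + b : c w + d) and (a : c). Vanishing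
  of a form does not depend on the scaling of the coordinates, so infinity is treated like any other
  point.\<close>

lemma roots_cp1_moebius:
  assumes f: "f \<in> polys_upto 2" "f \<noteq> 0" and det: "a * d - b * c \<noteq> 0"
  shows "moebius a b c d (Some w) \<in> roots_cp1 2 f \<longleftrightarrow> quad_form f (a * w + b) (c * w + d) = 0"
    and "moebius a b c d None \<in> roots_cp1 2 f \<longleftrightarrow> quad_form f a c = 0"
proof -
  have *: "(if y = 0 then None else Some (x / y)) \<in> roots_cp1 2 f \<longleftrightarrow> quad_form f x y = 0"
    if "x \<noteq> 0 \<or> y \<noteq> 0" for x y
  proof (cases "y = 0")
    case True
    then show ?thesis
      using that quad_form_scale[of f x 1 0] by (simp add: roots_cp1_None[OF f])
  next
    case False
    then show ?thesis
      using quad_form_scale[of f y "x / y" 1] by (simp add: roots_cp1_Some[OF f])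
  qed
  have "a * w + b \<noteq> 0 \<or> c * w + d \<noteq> 0"
  proof (rule ccontr)
    assume "\<not> ?thesis"
    then have "a * w + b = 0" "c * w + d = 0" by auto
    moreover have "a * d - b * c = a * (c * w + d) - c * (a * w + b)"
      by (simp add: algebra_simps)
    ultimately show False using det by simp
  qed
  from *[OF this]
  show "moebius a b c d (Some w) \<in> roots_cp1 2 f \<longleftrightarrow> quad_form f (a * w + b) (c * w + d) = 0"
    by (simp add: moebius_def)
  have "a \<noteq> 0 \<or> c \<noteq> 0" using det by auto
  from *[OF this] show "moebius a b c d None \<in> roots_cp1 2 f \<longleftrightarrow> quad_form f a c = 0"
    by (simp add: moebius_def)
qed

lemma inj_moebius:
  assumes "a * d - b * c \<noteq> 0"
  shows "inj (moebius a b c d)"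
proof -
  have eq: "(a * v + b) * (c * w + d) - (a * w + b) * (c * v + d) = (a * d - b * c) * (v - w)"
    for v w by (simp add: algebra_simps)
  have fin: "moebius a b c d (Some w) \<noteq> moebius a b c d None" for w
  proof
    assume "moebius a b c d (Some w) = moebius a b c d None"
    then have "(a * w + b) * c = a * (c * w + d)"
      by (auto simp: moebius_def field_simps split: if_splits)
    with assms show False by (simp add: algebra_simps)
  qed
  have "v = w" if "moebius a b c d (Some v) = moebius a b c d (Some w)" for v w
  proof -
    have "(a * v + b) * (c * w + d) = (a * w + b) * (c * v + d)"
      using that by (auto simp: moebius_def frac_eq_eq split: if_splits)
    with eq[of v w] assms show ?thesis by simp
  qed
  with fin show ?thesis
    by (auto simp: inj_def) (metis fin option.exhaust)
qed

text \<open>Pulling both forms back along the Moebius map reduces the claim to the unit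
  disc.\<close>

theorem grace_quadratic:
  assumes D: "open_disc D"
    and p: "p \<in> polys_upto 2" "p \<noteq> 0" "roots_cp1 2 p \<subseteq> D"
    and q: "q \<in> polys_upto 2" "q \<noteq> 0"
    and "apolar p q = 0"
  shows "roots_cp1 2 q \<inter> D \<noteq> {}"
proof -
  obtain a b c d where det: "a * d - b * c \<noteq> 0" and D: "D = moebius a b c d ` Some ` ball 0 1"
    using D unfolding open_disc_def by blast
  note inj = inj_moebius[OF det]
  define M where "M f = coeff f 1 * (a * d + b * c) + 2 * coeff f 0 * c * d + 2 * coeff f 2 * a * b"
    for f :: "complex poly"
  have pull: "quad_form f (a * w + b) (c * w + d) =
      quad_form f b d + M f * w + quad_form f a c * w\<^sup>2" for f w
    by (simp add: quad_form_def M_def power2_eq_square algebra_simps)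
  \<comment> \<open>The image of infinity lies outside \<open>D\<close>, so it is no root of
    \<open>p\<close>: the pulled-back form keeps its leading coefficient.\<close>
  have "moebius a b c d None \<notin> D"
    using inj by (auto simp: D inj_def)
  then have "quad_form p a c \<noteq> 0"
    using p roots_cp1_moebius(2)[OF p(1,2) det] by blast
  moreover have "norm w < 1" if "quad_form p b d + M p * w + quad_form p a c * w\<^sup>2 = 0" for w
  proof -
    have "moebius a b c d (Some w) \<in> D"
      using that p roots_cp1_moebius(1)[OF p(1,2) det] pull by auto
    then show ?thesis
      by (auto simp: D dest!: injD[OF inj])
  qed
  \<comment> \<open>Invariance of apolarity: a change of coordinates multiplies it by the squared
    determinant.\<close>
  moreover have "2 * quad_form p b d * quad_form q a c - M p * M q +
      2 * quad_form p a c * quad_form q b d = (a * d - b * c)\<^sup>2 * apolar p q"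
    by (simp add: quad_form_def M_def apolar_def power2_eq_square algebra_simps)
  ultimately obtain w where "norm w < 1" "quad_form q b d + M q * w + quad_form q a c * w\<^sup>2 = 0"
    using grace_unit_disc[of "quad_form p a c" "quad_form p b d" "M p"
        "quad_form q a c" "M q" "quad_form q b d"] \<open>apolar p q = 0\<close>
    by auto
  then have "moebius a b c d (Some w) \<in> roots_cp1 2 q \<inter> D"
    using roots_cp1_moebius(1)[OF q det] pull by (auto simp: D)
  then show ?thesis by blast
qed

section \<open>Counting roots on the projective line\<close>

lemma roots_cp1_subset:
  assumes "f \<noteq> 0"
  shows "roots_cp1 k f \<subseteq> insert None (Some ` {x. poly f x = 0})"
proof
  fix z assume "z \<in> roots_cp1 k f"
  then show "z \<in> insert None (Some ` {x. poly f x = 0})"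
    using assms by (cases z) (auto simp: roots_cp1_def root_mult_def order_gt_0_iff)
qed

lemma finite_roots_cp1:
  assumes "f \<noteq> 0"
  shows "finite (roots_cp1 k f)"
  using roots_cp1_subset[OF assms] by (rule finite_subset) (simp add: poly_roots_finite assms)

text \<open>Points that are not roots contribute 0, so a product and its factors can be summed over
  one common set.\<close>

lemma num_roots_in_superset:
  assumes "finite S" "roots_cp1 k f \<subseteq> S"
  shows "num_roots_in k f D = (\<Sum>z\<in>S \<inter> D. root_mult k f z)"
  unfolding num_roots_in_def using assms
  by (intro sum.mono_neutral_left) (auto simp: roots_cp1_def)

lemma num_roots_in_Un:
  assumes "f \<noteq> 0" "D \<inter> E = {}"
  shows "num_roots_in k f (D \<union> E) = num_roots_in k f D + num_roots_in k f E"
  unfolding num_roots_in_def Int_Un_distrib using assms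
  by (intro sum.union_disjoint) (auto simp: finite_roots_cp1)

lemma num_roots_in_pos:
  assumes "f \<noteq> 0" "roots_cp1 k f \<inter> D \<noteq> {}"
  shows "num_roots_in k f D > 0"
  unfolding num_roots_in_def using assms finite_roots_cp1[OF assms(1), of k]
  by (intro sum_pos) (blast, blast, simp add: roots_cp1_def)

text \<open>The finite roots account for at most \<open>degree f\<close>, and infinity for the
  missing \<open>k - degree f\<close>.\<close>

lemma num_roots_in_le:
  assumes "f \<noteq> 0" "f \<in> polys_upto k"
  shows "num_roots_in k f D \<le> k"
proof -
  let ?S = "insert None (Some ` {x. poly f x = 0})"
  have fin: "finite {x. poly f x = 0}"
    using assms by (simp add: poly_roots_finite)
  have "num_roots_in k f D \<le> (\<Sum>z\<in>?S. root_mult k f z)"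
    unfolding num_roots_in_def using fin roots_cp1_subset[OF assms(1), of k] by (intro sum_mono2) auto
  also have "\<dots> = (k - degree f) + (\<Sum>x | poly f x = 0. order x f)"
    using fin by (subst sum.insert) (auto simp: sum.reindex root_mult_def)
  also have "\<dots> \<le> (k - degree f) + degree f"
    using sum_order_le_degree[OF assms(1)] by simp
  finally show ?thesis
    using assms(2) by (simp add: polys_upto_def)
qed

text \<open>At infinity the degree defects add because degrees do; the degree bounds keep the
  subtractions from truncating.\<close>

lemma root_mult_mult:
  assumes "f \<in> polys_upto k" "g \<in> polys_upto l" "f * g \<noteq> 0"
  shows "root_mult (k + l) (f * g) z = root_mult k f z + root_mult l g z"
  using assms by (auto simp: root_mult_def polys_upto_def order_mult degree_mult_eq split: option.split)

lemma polys_upto_mult: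
  "f \<in> polys_upto k \<Longrightarrow> g \<in> polys_upto l \<Longrightarrow> f * g \<in> polys_upto (k + l)"
  unfolding polys_upto_def using degree_mult_le[of f g] by auto

lemma num_roots_in_mult:
  assumes "f \<in> polys_upto k" "g \<in> polys_upto l" "f * g \<noteq> 0"
  shows "num_roots_in (k + l) (f * g) D = num_roots_in k f D + num_roots_in l g D"
proof -
  let ?S = "roots_cp1 (k + l) (f * g)"
  have "roots_cp1 k f \<subseteq> ?S" "roots_cp1 l g \<subseteq> ?S"
    using root_mult_mult[OF assms] by (auto simp: roots_cp1_def)
  with finite_roots_cp1[OF assms(3)] show ?thesis
    by (simp add: num_roots_in_superset[of ?S] root_mult_mult[OF assms] sum.distrib)
qed

section \<open>Brackets and apolarity\<close>

text \<open>The cubic terms of the two products cancel, so the degree stays at most 2.\<close>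

lemma coeff_bracket:
  assumes "p \<in> polys_upto 2" "q \<in> polys_upto 2"
  shows "coeff (bracket p q) 0 = coeff p 1 * coeff q 0 - coeff p 0 * coeff q 1"
    and "coeff (bracket p q) 1 = 2 * (coeff p 2 * coeff q 0 - coeff p 0 * coeff q 2)"
    and "coeff (bracket p q) 2 = coeff p 2 * coeff q 1 - coeff p 1 * coeff q 2"
    and "bracket p q \<in> polys_upto 2"
proof -
  have rep: "f = [:coeff f 0, coeff f 1, coeff f 2:]" if "f \<in> polys_upto 2" for f :: "complex poly"
    using that by (intro poly_eqI)
      (auto simp: polys_upto_def coeff_pCons coeff_eq_0 numeral_2_eq_2 split: nat.split)
  obtain a b c where p: "p = [:a, b, c:]" using rep[OF assms(1)] by blast
  obtain d e f where q: "q = [:d, e, f:]" using rep[OF assms(2)] by blast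
  have *: "bracket p q = [:b * d - a * e, 2 * (c * d - a * f), c * e - b * f:]"
    by (simp add: p q bracket_def pderiv_pCons algebra_simps)
  show "coeff (bracket p q) 0 = coeff p 1 * coeff q 0 - coeff p 0 * coeff q 1"
    "coeff (bracket p q) 1 = 2 * (coeff p 2 * coeff q 0 - coeff p 0 * coeff q 2)"
    "coeff (bracket p q) 2 = coeff p 2 * coeff q 1 - coeff p 1 * coeff q 2"
    unfolding * by (simp_all add: p q numeral_2_eq_2)
  show "bracket p q \<in> polys_upto 2"
    unfolding * polys_upto_def by simp
qed

text \<open>Cofactor expansion along the column of \<open>p\<close>: the cofactors are bracket
  coefficients up to constants.\<close>

lemma Delta_eq_apolar:
  assumes "q \<in> polys_upto 2" "r \<in> polys_upto 2"
  shows "apolar p (bracket q r) = - 2 * Delta p q r"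
  by (simp add: apolar_def Delta_def det_3 coeff_bracket[OF assms, unfolded One_nat_def] algebra_simps)

lemma roots_cp1_nonempty:
  assumes "f \<in> polys_upto 2" "f \<noteq> 0"
  shows "roots_cp1 2 f \<noteq> {}"
proof (cases "degree f = 0")
  case True
  then have "None \<in> roots_cp1 2 f"
    by (simp add: roots_cp1_def root_mult_def)
  then show ?thesis by blast
next
  case False
  then obtain x where "poly f x = 0"
    using fundamental_theorem_of_algebra[of f] by (auto simp: constant_degree)
  then have "Some x \<in> roots_cp1 2 f"
    using assms by (simp add: roots_cp1_Some poly_eq_quad_form)
  then show ?thesis by blast
qed

text \<open>A zero bracket makes all 2 by 2 minors vanish, so the coefficient vectors are
  proportional and any root of \<open>p\<close> is also a root of \<open>q\<close>.\<close>

lemma bracket_nonzero: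
  assumes p: "p \<in> polys_upto 2" "p \<noteq> 0" and q: "q \<in> polys_upto 2" "q \<noteq> 0"
    and disj: "roots_cp1 2 p \<inter> roots_cp1 2 q = {}"
  shows "bracket p q \<noteq> 0"
proof
  assume "bracket p q = 0"
  then have minors: "coeff p 1 * coeff q 0 = coeff p 0 * coeff q 1"
      "coeff p 2 * coeff q 0 = coeff p 0 * coeff q 2"
      "coeff p 2 * coeff q 1 = coeff p 1 * coeff q 2"
    using coeff_bracket(1-3)[OF p(1) q(1)] by auto
  obtain i where i: "i \<le> 2" "coeff p i \<noteq> 0"
    using p by (metis leading_coeff_0_iff mem_Collect_eq polys_upto_def)
  then consider "i = 0" | "i = 1" | "i = 2" by linarith
  then have "coeff p i * coeff q k = coeff q i * coeff p k" if "k \<in> {0, 1, 2}" for k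
    by cases (use that minors in \<open>auto simp: mult.commute\<close>)
  then have "coeff p i * quad_form q x y = coeff q i * quad_form p x y" for x y
    by (simp add: quad_form_def distrib_left mult.assoc[symmetric])
  then have zero: "quad_form q x y = 0" if "quad_form p x y = 0" for x y
    using that i(2) by (metis mult_eq_0_iff)
  obtain z where "z \<in> roots_cp1 2 p"
    using roots_cp1_nonempty[OF p] by blast
  moreover from this have "z \<in> roots_cp1 2 q"
    using zero roots_cp1_Some[OF p] roots_cp1_Some[OF q] roots_cp1_None[OF p] roots_cp1_None[OF q]
    by (cases z) auto
  ultimately show False using disj by blast
qed

lemma num_roots_in_bracket:
  assumes discs: "open_disc D" "open_disc E" "D \<inter> E = {}" "D \<inter> F = {}" "E \<inter> F = {}"
    and p: "p \<in> polys_upto 2" "p \<noteq> 0" "roots_cp1 2 p \<subseteq> D"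
    and q: "q \<in> polys_upto 2" "q \<noteq> 0" "roots_cp1 2 q \<subseteq> E"
  shows "bracket p q \<noteq> 0"
    and "num_roots_in 2 (bracket p q) D = 1"
    and "num_roots_in 2 (bracket p q) E = 1"
    and "num_roots_in 2 (bracket p q) F = 0"
proof -
  show nz: "bracket p q \<noteq> 0"
    using discs p q by (intro bracket_nonzero) auto
  note br = coeff_bracket[OF p(1) q(1)]
  \<comment> \<open>These are determinants with a repeated column.\<close>
  have "apolar p (bracket p q) = 0" "apolar q (bracket p q) = 0"
    by (simp_all add: apolar_def br[unfolded One_nat_def] algebra_simps)
  then have "num_roots_in 2 (bracket p q) D > 0" "num_roots_in 2 (bracket p q) E > 0"
    using grace_quadratic[OF discs(1) p br(4) nz] grace_quadratic[OF discs(2) q br(4) nz]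
    by (simp_all add: num_roots_in_pos[OF nz])
  moreover have "num_roots_in 2 (bracket p q) D + num_roots_in 2 (bracket p q) E +
      num_roots_in 2 (bracket p q) F = num_roots_in 2 (bracket p q) (D \<union> E \<union> F)"
    using discs(3-5) by (simp add: num_roots_in_Un[OF nz] Int_Un_distrib2)
  moreover have "\<dots> \<le> 2"
    by (rule num_roots_in_le[OF nz br(4)])
  ultimately show "num_roots_in 2 (bracket p q) D = 1" "num_roots_in 2 (bracket p q) E = 1"
      "num_roots_in 2 (bracket p q) F = 0"
    by linarith+
qed

theorem proposition3p3:
  fixes D1 D2 D3 :: "cp1 set" and p1 p2 p3 :: "complex poly"
  assumes "disjoint_discs (D1, D2, D3)"
    and "p1 \<in> polys_upto 2" "p2 \<in> polys_upto 2" "p3 \<in> polys_upto 2"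
    and "p1 \<noteq> 0" "p2 \<noteq> 0" "p3 \<noteq> 0"
    and "roots_cp1 2 p1 \<subseteq> D1" "roots_cp1 2 p2 \<subseteq> D2" "roots_cp1 2 p3 \<subseteq> D3"
  shows "Delta p1 p2 p3 \<noteq> 0 \<and>
    subordinate (bracket p2 p3 * bracket p3 p1 * bracket p1 p2) (D1, D2, D3)"
proof -
  have D: "open_disc D1" "open_disc D2" "open_disc D3"
      "D1 \<inter> D2 = {}" "D2 \<inter> D3 = {}" "D3 \<inter> D1 = {}"
      "D2 \<inter> D1 = {}" "D3 \<inter> D2 = {}" "D1 \<inter> D3 = {}"
    using assms(1) by (auto simp: disjoint_discs_def)
  let ?J1 = "bracket p2 p3" and ?J2 = "bracket p3 p1" and ?J3 = "bracket p1 p2"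
  \<comment> \<open>Cyclic shifts of the indices: each bracket has one root in the disc of each of
    its arguments and none in the third disc.\<close>
  note J1 = num_roots_in_bracket[OF D(2,3,5,7,6) assms(3,6,9) assms(4,7,10)]
  note J2 = num_roots_in_bracket[OF D(3,1,6,8,4) assms(4,7,10) assms(2,5,8)]
  note J3 = num_roots_in_bracket[OF D(1,2,4,9,5) assms(2,5,8) assms(3,6,9)]
  note in2 = coeff_bracket(4)[OF assms(3,4)] coeff_bracket(4)[OF assms(4,2)]
    coeff_bracket(4)[OF assms(2,3)]
  have "Delta p1 p2 p3 \<noteq> 0"
  proof
    assume "Delta p1 p2 p3 = 0"
    then have "apolar p1 ?J1 = 0"
      by (simp add: Delta_eq_apolar[OF assms(3,4)])
    then have "roots_cp1 2 ?J1 \<inter> D1 \<noteq> {}"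
      by (rule grace_quadratic[OF D(1) assms(2,5,8) in2(1) J1(1)])
    then have "num_roots_in 2 ?J1 D1 > 0"
      by (rule num_roots_in_pos[OF J1(1)])
    with J1(4) show False by simp
  qed
  moreover have "subordinate (?J1 * ?J2 * ?J3) (D1, D2, D3)"
  proof -
    have in4: "?J1 * ?J2 \<in> polys_upto 4"
      using polys_upto_mult[OF in2(1,2)] by simp
    have "num_roots_in 6 (?J1 * ?J2 * ?J3) D =
        num_roots_in 2 ?J1 D + num_roots_in 2 ?J2 D + num_roots_in 2 ?J3 D" for D
      using num_roots_in_mult[OF in4 in2(3), of D] num_roots_in_mult[OF in2(1,2), of D]
        J1(1) J2(1) J3(1) by simp
    moreover have "?J1 * ?J2 * ?J3 \<in> polys_upto 6"
      using polys_upto_mult[OF in4 in2(3)] by simp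
    \<comment> \<open>In each disc the three counts are 1, 1 and 0 in some order.\<close>
    ultimately show ?thesis
      using assms(1) J1 J2 J3 by (simp add: subordinate_def)
  qed
  ultimately show ?thesis by blast
qed

end
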